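(* The function $z_{\mathrm{linx}}(\Upsilon)$ is convex in $\log\Upsilon$; that is, the function $\psi\mapsto z_{\mathrm{linx}}\big((e^{\psi_1},\dots,e^{\psi_n})^\top\big)$ is convex on $\mathbb{R}^n$.
   Context: Let $n>1$, let $s$ be an integer with $0<s<n$, let $C\in\mathbb{R}^{n\times n}$ be a symmetric positive semidefinite matrix with $\operatorname{rank}(C)\ge s$, and let $A\in\mathbb{R}^{m\times n}$, $b\in\mathbb{R}^m$. Notation: $\mathbf{e}$ is the all-ones vector; $\operatorname{ldet}$ is the natural logarithm of the determinant, with value $-\infty$ on singular positive semidefinite matrices; $\operatorname{Diag}(v)$ is the diagonal matrix with diagonal $v$; $\log$ of a vector is taken componentwise. The maximum over an empty set is $-\infty$ (the constant function $-\infty$ counts as convex). For $\Upsilon=(\gamma_1,\dots,\gamma_n)^\top\in\mathbb{R}^n_{++}$ (all entries positive) and $x\in[0,1]^n$, let $$f_{\mathrm{linx}}(x;\Upsilon):=\tfrac12\operatorname{ldet}\big(\operatorname{Diag}(\Upsilon)C\operatorname{Diag}(x)C\operatorname{Diag}(\Upsilon)+\operatorname{Diag}(\mathbf{e}-x)\big)-\sum_{i=1}^n x_i\log\gamma_i ,$$ and let the g-scaled linx bound be $$z_{\mathrm{linx}}(\Upsilon):=\max\{f_{\mathrm{linx}}(x;\Upsilon) : \mathbf{e}^\top x=s,\ 0\le x\le\mathbf{e},\ Ax\le b\}.$$ *)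

theory Defs
  imports "HOL-Analysis.Analysis"
begin

definition diag_matrix :: "real ^ 'n \<Rightarrow> real ^ 'n ^ 'n" where
  "diag_matrix v = (\<chi> i j. if i = j then v $ i else 0)"

definition psd :: "real ^ 'n ^ 'n \<Rightarrow> bool" where
  "psd M \<longleftrightarrow> transpose M = M \<and> (\<forall>v. 0 \<le> v \<bullet> (M *v v))"

(* Only used on positive semidefinite matrices, where "det M \<le> 0" means that M is singular. *)
definition ldet :: "real ^ 'n ^ 'n \<Rightarrow> ereal" where
  "ldet M = (if 0 < det M then ereal (ln (det M)) else - \<infinity>)"

definition linx_matrix :: "real ^ 'n ^ 'n \<Rightarrow> real ^ 'n \<Rightarrow> real ^ 'n \<Rightarrow> real ^ 'n ^ 'n" where
  "linx_matrix C \<Upsilon> x =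
     diag_matrix \<Upsilon> ** C ** diag_matrix x ** C ** diag_matrix \<Upsilon> + diag_matrix (1 - x)"

definition f_linx :: "real ^ 'n ^ 'n \<Rightarrow> real ^ 'n \<Rightarrow> real ^ 'n \<Rightarrow> ereal" where
  "f_linx C x \<Upsilon> =
     ereal (1 / 2) * ldet (linx_matrix C \<Upsilon> x) - ereal (\<Sum>i\<in>UNIV. x $ i * ln (\<Upsilon> $ i))"

(* The order on vectors is componentwise, and "1 :: real ^ 'n" is the all-ones vector. *)
definition linx_feasible :: "real ^ 'n ^ 'm \<Rightarrow> real ^ 'm \<Rightarrow> nat \<Rightarrow> (real ^ 'n) set" where
  "linx_feasible A b s = {x. 1 \<bullet> x = real s \<and> 0 \<le> x \<and> x \<le> 1 \<and> A *v x \<le> b}"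

(* The supremum is a maximum whenever the feasible set is nonempty (lemma z_linx_attained),
   and it is -\<infinity> on an empty feasible set (lemma z_linx_infeasible). *)
definition z_linx ::
  "real ^ 'n ^ 'n \<Rightarrow> real ^ 'n ^ 'm \<Rightarrow> real ^ 'm \<Rightarrow> nat \<Rightarrow> real ^ 'n \<Rightarrow> ereal" where
  "z_linx C A b s \<Upsilon> = (SUP x\<in>linx_feasible A b s. f_linx C x \<Upsilon>)"

(* Extended-real version of convex_on. In ereal, 0 * (- \<infinity>) = 0, so a weight 0 ignores the
   corresponding point; \<infinity> + (- \<infinity>) = \<infinity>, so the definition agrees with convexity of the epigraph. *)
definition ereal_convex_on :: "'a::real_vector set \<Rightarrow> ('a \<Rightarrow> ereal) \<Rightarrow> bool" where
  "ereal_convex_on S f \<longleftrightarrow> convex S \<and>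
     (\<forall>x\<in>S. \<forall>y\<in>S. \<forall>u\<ge>0. \<forall>v\<ge>0. u + v = 1 \<longrightarrow>
        f (u *\<^sub>R x + v *\<^sub>R y) \<le> ereal u * f x + ereal v * f y)"

lemma ereal_convex_on_ereal_iff: "ereal_convex_on S (\<lambda>x. ereal (f x)) \<longleftrightarrow> convex_on S f"
  by (auto simp: ereal_convex_on_def convex_on_def)

lemma ereal_convex_on_epigraph:
  "ereal_convex_on S f \<longleftrightarrow> convex {(x, r). x \<in> S \<and> f x \<le> ereal r}" if "convex S"
proof
  assume L: "ereal_convex_on S f"
  show "convex {(x, r). x \<in> S \<and> f x \<le> ereal r}"
    unfolding convex_def
  proof clarsimp
    fix x r y q and u v :: real
    assume H: "x \<in> S" "f x \<le> ereal r" "y \<in> S" "f y \<le> ereal q" "0 \<le> u" "0 \<le> v" "u + v = 1"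
    have "f (u *\<^sub>R x + v *\<^sub>R y) \<le> ereal u * f x + ereal v * f y"
      using L H by (auto simp: ereal_convex_on_def)
    also have "\<dots> \<le> ereal u * ereal r + ereal v * ereal q"
      by (intro add_mono ereal_mult_left_mono) (use H in auto)
    finally show "u *\<^sub>R x + v *\<^sub>R y \<in> S \<and> f (u *\<^sub>R x + v *\<^sub>R y) \<le> ereal (u * r + v * q)"
      using H \<open>convex S\<close> by (auto simp: convex_def)
  qed
next
  assume R: "convex {(x, r). x \<in> S \<and> f x \<le> ereal r}"
  have key: "f (u *\<^sub>R x + v *\<^sub>R y) \<le> ereal (u * r + v * q)"
    if "x \<in> S" "f x \<le> ereal r" "y \<in> S" "f y \<le> ereal q" "0 \<le> u" "0 \<le> v" "u + v = 1"
    for x r y q u v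
    using convexD[OF R, of "(x, r)" "(y, q)" u v] that by auto
  show "ereal_convex_on S f"
    unfolding ereal_convex_on_def
  proof (intro conjI ballI allI impI \<open>convex S\<close>)
    fix x y and u v :: real
    assume H: "x \<in> S" "y \<in> S" "0 \<le> u" "0 \<le> v" "u + v = 1"
    consider "u = 0" | "v = 0" | "0 < u" "0 < v" using H by linarith
    then show "f (u *\<^sub>R x + v *\<^sub>R y) \<le> ereal u * f x + ereal v * f y"
    proof cases
      case 3
      have bot: "f (u *\<^sub>R x + v *\<^sub>R y) = - \<infinity>"
        if "f x \<le> ereal a" "f y \<le> ereal c" "f x = - \<infinity> \<or> f y = - \<infinity>" for a c
      proof (rule ereal_bot)
        fix B
        show "f (u *\<^sub>R x + v *\<^sub>R y) \<le> ereal B"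
        proof (cases "f x = - \<infinity>")
          case True
          then show ?thesis
            using key[of x "(B - v * c) / u" y c u v] H that(2) \<open>0 < u\<close> by simp
        next
          case False
          then show ?thesis
            using key[of x a y "(B - u * a) / v" u v] H that(1,3) \<open>0 < v\<close> by simp
        qed
      qed
      show ?thesis
      proof (cases "f x"; cases "f y")
        fix a c
        assume "f x = ereal a" "f y = ereal c"
        then show ?thesis using key[of x a y c u v] H by simp
      next
        fix a
        assume "f x = ereal a" "f y = - \<infinity>"
        then show ?thesis using bot[of a 0] by simp
      next
        fix c
        assume "f x = - \<infinity>" "f y = ereal c"
        then show ?thesis using bot[of 0 c] by simp
      next
        assume "f x = - \<infinity>" "f y = - \<infinity>"
        then show ?thesis using bot[of 0 0] by simp
      qed (use \<open>0 < u\<close> \<open>0 < v\<close> in simp_all)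
    qed (use H in \<open>auto simp: zero_ereal_def[symmetric]\<close>)
  qed
qed

lemma z_linx_infeasible: "linx_feasible A b s = {} \<Longrightarrow> z_linx C A b s \<Upsilon> = - \<infinity>"
  by (simp add: z_linx_def bot_ereal_def)

lemma compact_linx_feasible: "compact (linx_feasible A b s)"
proof -
  have "closed (linx_feasible A b s)"
    unfolding linx_feasible_def less_eq_vec_def
    by (intro closed_Collect_conj closed_Collect_eq closed_Collect_all closed_Collect_le
        continuous_intros)
  moreover have "linx_feasible A b s \<subseteq> cbox 0 1"
    by (auto simp: linx_feasible_def mem_box_cart less_eq_vec_def)
  ultimately show ?thesis
    by (meson bounded_cbox bounded_subset compact_eq_bounded_closed)
qed

lemma z_linx_attained:
  fixes C :: "real ^ 'n ^ 'n"
  assumes "linx_feasible A b s \<noteq> {}"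
  shows "\<exists>x\<in>linx_feasible A b s. z_linx C A b s \<Upsilon> = f_linx C x \<Upsilon>"
proof -
  define K where "K = linx_feasible A b s"
  define S where "S x = (\<Sum>i\<in>UNIV. x $ i * ln (\<Upsilon> $ i))" for x
  define p where "p x = det (linx_matrix C \<Upsilon> x) * exp (- 2 * S x)" for x
  have f: "f_linx C x \<Upsilon> = (if 0 < p x then ereal (ln (p x) / 2) else - \<infinity>)" for x
    by (auto simp: f_linx_def ldet_def p_def S_def[symmetric] ln_mult zero_less_mult_iff
        field_simps)
  have diag: "continuous_on UNIV (\<lambda>x. diag_matrix (g x) $ i $ j)"
    if "\<And>i. continuous_on UNIV (\<lambda>x. g x $ i)" for g :: "real ^ 'n \<Rightarrow> real ^ 'n" and i j
    using that by (cases "i = j") (simp_all add: diag_matrix_def)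
  have "continuous_on UNIV (\<lambda>x. linx_matrix C \<Upsilon> x $ i $ j)" for i j
    unfolding linx_matrix_def matrix_matrix_mult_def vector_add_component vec_lambda_beta
    by (intro continuous_on_add continuous_on_sum continuous_on_mult continuous_on_const diag)
      (simp_all, (intro continuous_on_diff continuous_on_const continuous_on_component continuous_on_id)+)
  then have "continuous_on UNIV p"
    unfolding p_def S_def det_def
    by (intro continuous_on_mult continuous_on_sum continuous_on_prod continuous_on_exp
        continuous_on_const) (auto intro: continuous_on_component continuous_on_id)
  then have "continuous_on K p" using continuous_on_subset by blast
  then obtain x where x: "x \<in> K" "\<And>y. y \<in> K \<Longrightarrow> p y \<le> p x"
    using continuous_attains_sup[of K p] compact_linx_feasible assms unfolding K_def by metis
  have "f_linx C y \<Upsilon> \<le> f_linx C x \<Upsilon>" if "y \<in> K" for y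
    using x(2)[OF that] by (auto simp: f)
  then have "z_linx C A b s \<Upsilon> = f_linx C x \<Upsilon>"
    unfolding z_linx_def K_def[symmetric] using x(1) by (intro SUP_eqI) auto
  then show ?thesis using x(1) K_def by blast
qed

end

theory Submission
  imports Defs
begin

text \<open>
  For a fixed feasible \<open>x\<close>, put \<open>M = C Diag(x) C\<close>, which is positive semidefinite. The
  Leibniz formula gives, for \<open>D = Diag(\<gamma>)\<close>,

    \<open>det (D M D + Diag(1 - x)) = (\<Sum>S. (\<Prod>i\<notin>S. 1 - x\<^sub>i) * det M\<^sub>S * (\<Prod>i\<in>S. \<gamma>\<^sub>i\<^sup>2))\<close>,

  where \<open>S\<close> ranges over all sets of indices and \<open>M\<^sub>S\<close> is the principal submatrix of \<open>M\<close> on \<open>S\<close>.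
  Principal minors of \<open>M\<close> are nonnegative and \<open>x \<le> 1\<close>, so with \<open>\<gamma>\<^sub>i = exp \<psi>\<^sub>i\<close> the right-hand side
  is a nonnegative combination of exponentials of linear functions of \<open>\<psi>\<close>
  (\<open>det_linx_matrix_exp\<close>). Its logarithm is a log-sum-exp function, hence convex
  (\<open>sum_exp_le_exp_ln_sums\<close>), unless all coefficients vanish, and then it is \<open>- \<infinity>\<close> for every \<open>\<psi>\<close>.
  The remaining term of the objective is linear in \<open>\<psi>\<close>. Therefore the bound is a supremum of
  convex functions, one for each feasible \<open>x\<close>.
\<close>

section \<open>Nonnegative principal minors\<close>

lemma inner_matrix_vector_mult:
  fixes M :: "real ^ 'n ^ 'm"
  shows "x \<bullet> (M *v y) = (transpose M *v x) \<bullet> y"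
  by (simp add: dot_lmul_matrix transpose_matrix_vector)

text \<open>On the segment from the identity to a positive semidefinite matrix, every point but the
  last is positive definite, hence nonsingular; so the determinant cannot change sign.\<close>

lemma det_psd_nonneg:
  fixes M :: "real ^ 'n ^ 'n"
  assumes "psd M"
  shows "0 \<le> det M"
proof (rule ccontr)
  assume neg: "\<not> 0 \<le> det M"
  define g where "g t = det (t *\<^sub>R M + (1 - t) *\<^sub>R mat 1)" for t :: real
  have "continuous_on {0..1} g"
    unfolding g_def det_def by (intro continuous_intros)
  moreover have "g 0 = 1" "g 1 < 0" using neg by (simp_all add: g_def)
  ultimately obtain t where t: "0 \<le> t" "t \<le> 1" "g t = 0"
    using IVT2'[of g 1 0 0] by auto
  with \<open>g 1 < 0\<close> have "t < 1" by (cases "t = 1") auto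
  obtain v where v: "v \<noteq> 0" "(t *\<^sub>R M + (1 - t) *\<^sub>R mat 1) *v v = 0"
    using \<open>g t = 0\<close> unfolding g_def
    by (metis invertible_det_nz invertible_left_inverse matrix_left_invertible_ker)
  have "0 = v \<bullet> ((t *\<^sub>R M + (1 - t) *\<^sub>R mat 1) *v v)"
    using v by simp
  also have "\<dots> = t * (v \<bullet> (M *v v)) + (1 - t) * (v \<bullet> v)"
    by (simp add: matrix_vector_mult_add_rdistrib scaleR_matrix_vector_assoc[symmetric] inner_add_right)
  also have "\<dots> > 0"
  proof (rule add_nonneg_pos)
    show "0 \<le> t * (v \<bullet> (M *v v))"
      using assms t(1) by (simp add: psd_def)
    show "0 < (1 - t) * (v \<bullet> v)"
      using \<open>t < 1\<close> v(1) by simp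
  qed
  finally show False by simp
qed

text \<open>Dimensions are types, so a principal submatrix is represented inside the full index type,
  extended by the identity; its determinant is then the principal minor.\<close>

definition principal_block :: "'n set \<Rightarrow> real ^ 'n ^ 'n \<Rightarrow> real ^ 'n ^ 'n" where
  "principal_block S M =
     (\<chi> i j. if i \<in> S \<and> j \<in> S then M $ i $ j else if i = j then 1 else 0)"

text \<open>The quadratic form splits into that of \<open>M\<close> at the restriction of \<open>v\<close> to \<open>S\<close> and the squares of
  the remaining coordinates, which come from the identity part.\<close>

lemma psd_principal_block:
  fixes M :: "real ^ 'n ^ 'n"
  assumes "psd M"
  shows "psd (principal_block S M)"
  unfolding psd_def
proof (intro conjI allI)
  have "transpose M = M"
    using assms by (simp add: psd_def)
  then have "M $ i $ j = M $ j $ i" for i j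
    by (simp add: transpose_def vec_eq_iff)
  then show "transpose (principal_block S M) = principal_block S M"
    by (auto simp: transpose_def principal_block_def vec_eq_iff)
next
  fix v :: "real ^ 'n"
  define w where "w = (\<chi> i. if i \<in> S then v $ i else 0)"
  have row: "v $ i * (principal_block S M *v v) $ i =
      w $ i * (M *v w) $ i + (if i \<in> S then 0 else (v $ i)\<^sup>2)" for i
  proof (cases "i \<in> S")
    case True
    then have "(principal_block S M *v v) $ i = (M *v w) $ i"
      by (auto simp: principal_block_def w_def matrix_vector_mult_def intro!: sum.cong)
    with True show ?thesis by (simp add: w_def)
  next
    case False
    then have "principal_block S M $ i $ j * v $ j = (if i = j then v $ j else 0)" for j
      by (simp add: principal_block_def)
    then have "(principal_block S M *v v) $ i = v $ i"
      by (simp add: matrix_vector_mult_def)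
    with False show ?thesis by (simp add: w_def power2_eq_square)
  qed
  have "v \<bullet> (principal_block S M *v v) =
      w \<bullet> (M *v w) + (\<Sum>i\<in>UNIV. if i \<in> S then 0 else (v $ i)\<^sup>2)"
    unfolding inner_vec_def inner_real_def row by (rule sum.distrib)
  also have "\<dots> \<ge> 0"
    using assms by (intro add_nonneg_nonneg sum_nonneg) (auto simp: psd_def)
  finally show "0 \<le> v \<bullet> (principal_block S M *v v)" .
qed

section \<open>The determinant as a posynomial in the scaling vector\<close>

text \<open>Each factor of a Leibniz term is an entry of \<open>M\<close> plus an entry of the diagonal matrix. Choosing
  the diagonal matrix outside \<open>S\<close> leaves only permutations that fix the complement of \<open>S\<close>, and
  these are exactly the ones contributing to the principal minor on \<open>S\<close>.\<close>

lemma det_add_diag_matrix: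
  fixes M :: "real ^ 'n ^ 'n"
  shows "det (M + diag_matrix d) = (\<Sum>S\<in>UNIV. (\<Prod>i\<in>-S. d $ i) * det (principal_block S M))"
proof -
  have leibniz: "(\<Prod>i\<in>UNIV. (M + diag_matrix d) $ i $ p i) =
      (\<Sum>S\<in>UNIV. (\<Prod>i\<in>-S. d $ i) * (\<Prod>i\<in>UNIV. principal_block S M $ i $ p i))"
    if p: "p permutes UNIV" for p :: "'n \<Rightarrow> 'n"
  proof -
    have "(\<Prod>i\<in>UNIV. (M + diag_matrix d) $ i $ p i) =
        (\<Sum>S\<in>UNIV. (\<Prod>i\<in>S. M $ i $ p i) * (\<Prod>i\<in>-S. diag_matrix d $ i $ p i))"
      by (simp add: prod_add Compl_eq_Diff_UNIV)
    also have "\<dots> = (\<Sum>S\<in>UNIV. (\<Prod>i\<in>-S. d $ i) * (\<Prod>i\<in>UNIV. principal_block S M $ i $ p i))"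
    proof (rule sum.cong[OF refl])
      fix S :: "'n set"
      show "(\<Prod>i\<in>S. M $ i $ p i) * (\<Prod>i\<in>-S. diag_matrix d $ i $ p i) =
          (\<Prod>i\<in>-S. d $ i) * (\<Prod>i\<in>UNIV. principal_block S M $ i $ p i)"
      proof (cases "\<forall>i\<in>-S. p i = i")
        case True
        have "p i \<in> S" if "i \<in> S" for i
          using True that p by (metis ComplI permutes_def)
        then have "(\<Prod>i\<in>S. principal_block S M $ i $ p i) = (\<Prod>i\<in>S. M $ i $ p i)"
          by (intro prod.cong) (auto simp: principal_block_def)
        moreover have "(\<Prod>i\<in>-S. principal_block S M $ i $ p i) = 1"
          using True by (intro prod.neutral) (auto simp: principal_block_def)
        moreover have "(\<Prod>i\<in>-S. diag_matrix d $ i $ p i) = (\<Prod>i\<in>-S. d $ i)"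
          using True by (intro prod.cong) (auto simp: diag_matrix_def)
        moreover have "(\<Prod>i\<in>UNIV. principal_block S M $ i $ p i) =
            (\<Prod>i\<in>S. principal_block S M $ i $ p i) * (\<Prod>i\<in>-S. principal_block S M $ i $ p i)"
          by (subst prod.union_disjoint[symmetric]) auto
        ultimately show ?thesis by simp
      next
        case False
        then obtain i where i: "i \<notin> S" "i \<noteq> p i" by force
        then have "(\<Prod>i\<in>-S. diag_matrix d $ i $ p i) = 0"
          by (intro prod_zero) (auto simp: diag_matrix_def intro!: bexI[of _ i])
        moreover have "(\<Prod>i\<in>UNIV. principal_block S M $ i $ p i) = 0"
          using i by (intro prod_zero) (auto simp: principal_block_def intro!: exI[of _ i])
        ultimately show ?thesis by (simp only: mult_zero_left mult_zero_right)
      qed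
    qed
    finally show ?thesis .
  qed
  have "det (M + diag_matrix d) =
      (\<Sum>p | p permutes UNIV. \<Sum>S\<in>UNIV. (\<Prod>i\<in>-S. d $ i) *
        (of_int (sign p) * (\<Prod>i\<in>UNIV. principal_block S M $ i $ p i)))"
    unfolding det_def
    by (intro sum.cong) (simp_all only: mem_Collect_eq leibniz sum_distrib_left mult.left_commute[of "of_int k" for k])
  also have "\<dots> = (\<Sum>S\<in>UNIV. (\<Prod>i\<in>-S. d $ i) * det (principal_block S M))"
    unfolding det_def by (subst sum.swap) (simp add: sum_distrib_left)
  finally show ?thesis .
qed

lemma diag_matrix_mult_component:
  "(diag_matrix g ** M) $ i $ j = g $ i * M $ i $ j"
  "(M ** diag_matrix g) $ i $ j = M $ i $ j * g $ j"
  by (simp_all add: diag_matrix_def matrix_matrix_mult_def if_distrib if_distribR cong: if_cong)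

lemma det_diag_matrix: "det (diag_matrix g) = (\<Prod>i\<in>UNIV. g $ i)"
  by (subst det_diagonal) (simp_all add: diag_matrix_def)

text \<open>Scaling commutes with passing to a principal block, provided that the scaling is replaced
  by \<open>1\<close> outside \<open>S\<close> to preserve the identity part; then the determinant is multiplicative.\<close>

lemma det_principal_block_scaled:
  fixes M :: "real ^ 'n ^ 'n"
  shows "det (principal_block S (diag_matrix g ** M ** diag_matrix g)) =
    det (principal_block S M) * (\<Prod>i\<in>S. g $ i)\<^sup>2"
proof -
  define h where "h = (\<chi> i. if i \<in> S then g $ i else 1)"
  have "principal_block S (diag_matrix g ** M ** diag_matrix g) =
      diag_matrix h ** principal_block S M ** diag_matrix h"
    by (simp add: vec_eq_iff diag_matrix_mult_component)
      (simp add: principal_block_def diag_matrix_mult_component h_def)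
  moreover have "det (diag_matrix h) = (\<Prod>i\<in>S. g $ i)"
    by (simp add: det_diag_matrix h_def prod.If_cases)
  ultimately show ?thesis by (simp add: det_mul power2_eq_square)
qed

lemma psd_congruence_diag_matrix:
  fixes C :: "real ^ 'n ^ 'n"
  assumes "psd C" "0 \<le> x"
  shows "psd (C ** diag_matrix x ** C)"
proof -
  have C: "transpose C = C" using assms by (simp add: psd_def)
  have D: "transpose (diag_matrix x) = diag_matrix x"
    by (auto simp: transpose_def diag_matrix_def vec_eq_iff)
  have "0 \<le> v \<bullet> ((C ** diag_matrix x ** C) *v v)" for v
  proof -
    have "(diag_matrix x *v w) $ i = x $ i * w $ i" for w i
      by (simp add: diag_matrix_def matrix_vector_mult_def if_distrib if_distribR cong: if_cong)
    then have nonneg: "0 \<le> w \<bullet> (diag_matrix x *v w)" for w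
      using assms(2)
      by (auto simp: inner_vec_def less_eq_vec_def mult.left_commute[of "w $ i" for i]
          intro!: sum_nonneg)
    have "v \<bullet> ((C ** diag_matrix x ** C) *v v) = (C *v v) \<bullet> (diag_matrix x *v (C *v v))"
      by (simp add: matrix_vector_mul_assoc[symmetric] inner_matrix_vector_mult[of v C] C)
    then show ?thesis using nonneg by simp
  qed
  then show ?thesis
    by (simp add: psd_def matrix_transpose_mul C D matrix_mul_assoc)
qed

text \<open>The coefficients depend on \<open>x\<close> but not on \<open>\<psi>\<close>, which is what makes the determinant
  log-convex in \<open>\<psi>\<close>.\<close>

lemma det_linx_matrix_exp:
  fixes C :: "real ^ 'n ^ 'n"
  assumes "psd C" "0 \<le> x" "x \<le> 1"
  obtains c :: "'n set \<Rightarrow> real" where "\<And>S. 0 \<le> c S"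
    and "\<And>\<psi>. det (linx_matrix C (\<chi> i. exp (\<psi> $ i)) x) =
      (\<Sum>S\<in>UNIV. c S * exp (\<Sum>i\<in>S. 2 * \<psi> $ i))"
proof -
  define M where "M = C ** diag_matrix x ** C"
  define c where "c S = (\<Prod>i\<in>-S. (1 - x) $ i) * det (principal_block S M)" for S
  have "psd M" unfolding M_def using assms by (intro psd_congruence_diag_matrix)
  then have c: "0 \<le> c S" for S
    using assms unfolding c_def
    by (intro mult_nonneg_nonneg prod_nonneg det_psd_nonneg psd_principal_block)
      (auto simp: less_eq_vec_def)
  have "det (linx_matrix C (\<chi> i. exp (\<psi> $ i)) x) =
      (\<Sum>S\<in>UNIV. c S * exp (\<Sum>i\<in>S. 2 * \<psi> $ i))" for \<psi>
  proof -
    define g :: "real ^ 'n" where "g = (\<chi> i. exp (\<psi> $ i))"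
    have "(\<Prod>i\<in>S. g $ i)\<^sup>2 = exp (\<Sum>i\<in>S. 2 * \<psi> $ i)" for S
      by (simp only: g_def vec_lambda_beta prod_power_distrib exp_double exp_sum[OF finite])
    moreover have "linx_matrix C g x = diag_matrix g ** M ** diag_matrix g + diag_matrix (1 - x)"
      by (simp add: linx_matrix_def M_def matrix_mul_assoc)
    ultimately have "det (linx_matrix C g x) = (\<Sum>S\<in>UNIV. (\<Prod>i\<in>-S. (1 - x) $ i) *
        (det (principal_block S M) * exp (\<Sum>i\<in>S. 2 * \<psi> $ i)))"
      by (simp only: det_add_diag_matrix det_principal_block_scaled)
    then show ?thesis
      by (simp only: g_def c_def mult.assoc)
  qed
  with c show thesis by (rule that[of c])
qed

section \<open>Convexity\<close>

text \<open>This is the convexity of log-sum-exp, in exponentiated form. After normalising both sums to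
  \<open>1\<close>, it is the convexity of the exponential function applied term by term.\<close>

lemma sum_exp_le_exp_ln_sums:
  fixes a b c :: "'k \<Rightarrow> real"
  assumes "\<And>k. k \<in> K \<Longrightarrow> 0 \<le> c k" "0 \<le> u" "0 \<le> v" "u + v = 1"
    and P: "0 < (\<Sum>k\<in>K. c k * exp (a k))" and Q: "0 < (\<Sum>k\<in>K. c k * exp (b k))"
  shows "(\<Sum>k\<in>K. c k * exp (u * a k + v * b k)) \<le>
    exp (u * ln (\<Sum>k\<in>K. c k * exp (a k)) + v * ln (\<Sum>k\<in>K. c k * exp (b k)))"
proof -
  define P where "P = (\<Sum>k\<in>K. c k * exp (a k))"
  define Q where "Q = (\<Sum>k\<in>K. c k * exp (b k))"
  have pos: "0 < P" "0 < Q" using P Q by (simp_all add: P_def Q_def)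
  have "exp (u * (a k - ln P) + v * (b k - ln Q)) \<le> u * (exp (a k) / P) + v * (exp (b k) / Q)" for k
  proof -
    have "1 - v = u" "v \<le> 1" using assms(2-4) by simp_all
    then show ?thesis
      using convex_onD[OF exp_convex, of v "a k - ln P" "b k - ln Q"] assms(3) pos
      by (simp add: exp_diff)
  qed
  then have "(\<Sum>k\<in>K. c k * exp (u * (a k - ln P) + v * (b k - ln Q))) \<le>
      (\<Sum>k\<in>K. c k * (u * (exp (a k) / P) + v * (exp (b k) / Q)))"
    using assms(1) by (intro sum_mono mult_left_mono)
  also have "\<dots> = u * ((\<Sum>k\<in>K. c k * exp (a k)) / P) + v * ((\<Sum>k\<in>K. c k * exp (b k)) / Q)"
    by (simp add: sum.distrib sum_distrib_left sum_divide_distrib distrib_left mult.left_commute)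
  also have "\<dots> = 1"
    using pos assms(4) by (simp add: P_def[symmetric] Q_def[symmetric])
  finally have "(\<Sum>k\<in>K. c k * exp (u * (a k - ln P) + v * (b k - ln Q))) *
      exp (u * ln P + v * ln Q) \<le> exp (u * ln P + v * ln Q)"
    by simp
  moreover have "c k * exp (u * (a k - ln P) + v * (b k - ln Q)) * exp (u * ln P + v * ln Q) =
      c k * exp (u * a k + v * b k)" for k
    by (simp add: mult.assoc exp_add[symmetric] algebra_simps)
  ultimately show ?thesis
    by (simp add: sum_distrib_right P_def[symmetric] Q_def[symmetric])
qed

lemma ereal_convex_on_f_linx_exp:
  fixes C :: "real ^ 'n ^ 'n"
  assumes "psd C" "0 \<le> x" "x \<le> 1"
  shows "ereal_convex_on UNIV (\<lambda>\<psi>. f_linx C x (\<chi> i. exp (\<psi> $ i)))"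
proof -
  obtain c :: "'n set \<Rightarrow> real" where c: "\<And>S. 0 \<le> c S"
    and det: "\<And>\<psi>. det (linx_matrix C (\<chi> i. exp (\<psi> $ i)) x) =
      (\<Sum>S\<in>UNIV. c S * exp (\<Sum>i\<in>S. 2 * \<psi> $ i))"
    using det_linx_matrix_exp[OF assms] by blast
  define p where "p \<psi> = (\<Sum>S\<in>UNIV. c S * exp (\<Sum>i\<in>S. 2 * \<psi> $ i))" for \<psi> :: "real ^ 'n"
  have f: "f_linx C x (\<chi> i. exp (\<psi> $ i)) =
      ereal (1 / 2) * (if 0 < p \<psi> then ereal (ln (p \<psi>)) else - \<infinity>) -
      ereal (\<Sum>i\<in>UNIV. x $ i * \<psi> $ i)" for \<psi>
    by (simp add: f_linx_def ldet_def det p_def)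
  show ?thesis
  proof (cases "\<exists>S. 0 < c S")
    case False
    then have "c S = 0" for S using c[of S] by (metis less_eq_real_def)
    then have "f_linx C x (\<chi> i. exp (\<psi> $ i)) = - \<infinity>" for \<psi>
      by (simp add: f p_def)
    then show ?thesis
      by (simp add: ereal_convex_on_def)
  next
    case True
    then obtain S where "0 < c S" by blast
    then have pos: "0 < p \<psi>" for \<psi>
      unfolding p_def using c by (intro sum_pos2[where i = S]) auto
    define h where "h \<psi> = ln (p \<psi>) / 2 - (\<Sum>i\<in>UNIV. x $ i * \<psi> $ i)" for \<psi>
    have "h (u *\<^sub>R \<phi> + v *\<^sub>R \<psi>) \<le> u * h \<phi> + v * h \<psi>" if uv: "0 \<le> u" "0 \<le> v" "u + v = 1" for u v \<phi> \<psi>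
    proof -
      have "p (u *\<^sub>R \<phi> + v *\<^sub>R \<psi>) =
          (\<Sum>S\<in>UNIV. c S * exp (u * (\<Sum>i\<in>S. 2 * \<phi> $ i) + v * (\<Sum>i\<in>S. 2 * \<psi> $ i)))"
        by (simp add: p_def sum.distrib sum_distrib_left algebra_simps)
      also have "\<dots> \<le> exp (u * ln (p \<phi>) + v * ln (p \<psi>))"
        using sum_exp_le_exp_ln_sums[of UNIV c u v "\<lambda>S. \<Sum>i\<in>S. 2 * \<phi> $ i" "\<lambda>S. \<Sum>i\<in>S. 2 * \<psi> $ i"]
          c uv pos[of \<phi>] pos[of \<psi>] by (simp add: p_def)
      finally have "ln (p (u *\<^sub>R \<phi> + v *\<^sub>R \<psi>)) \<le> u * ln (p \<phi>) + v * ln (p \<psi>)"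
        using pos by (metis ln_exp ln_le_cancel_iff exp_gt_zero)
      moreover have "(\<Sum>i\<in>UNIV. x $ i * (u *\<^sub>R \<phi> + v *\<^sub>R \<psi>) $ i) =
          u * (\<Sum>i\<in>UNIV. x $ i * \<phi> $ i) + v * (\<Sum>i\<in>UNIV. x $ i * \<psi> $ i)"
        by (simp add: sum.distrib sum_distrib_left algebra_simps)
      ultimately show ?thesis
        by (simp add: h_def algebra_simps)
    qed
    moreover have "f_linx C x (\<chi> i. exp (\<psi> $ i)) = ereal (h \<psi>)" for \<psi>
      using pos[of \<psi>] by (simp add: f h_def)
    ultimately show ?thesis
      by (simp add: ereal_convex_on_def)
  qed
qed

lemma ereal_convex_on_SUP:
  assumes "convex S" "\<And>i. i \<in> I \<Longrightarrow> ereal_convex_on S (f i)"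
  shows "ereal_convex_on S (\<lambda>x. SUP i\<in>I. f i x)"
  unfolding ereal_convex_on_def
proof (intro conjI ballI allI impI SUP_least assms(1))
  fix x y i and u v :: real
  assume H: "x \<in> S" "y \<in> S" "0 \<le> u" "0 \<le> v" "u + v = 1" "i \<in> I"
  then have "f i (u *\<^sub>R x + v *\<^sub>R y) \<le> ereal u * f i x + ereal v * f i y"
    using assms(2) by (auto simp: ereal_convex_on_def)
  also have "\<dots> \<le> ereal u * (SUP i\<in>I. f i x) + ereal v * (SUP i\<in>I. f i y)"
    using H by (intro add_mono ereal_mult_left_mono SUP_upper) auto
  finally show "f i (u *\<^sub>R x + v *\<^sub>R y) \<le>
      ereal u * (SUP i\<in>I. f i x) + ereal v * (SUP i\<in>I. f i y)" .
qed

theorem theorem2: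
  fixes C :: "real ^ 'n ^ 'n" and A :: "real ^ 'n ^ 'm" and b :: "real ^ 'm" and s :: nat
  assumes "1 < CARD('n)"
    and "0 < s" and "s < CARD('n)"
    and "psd C" and "s \<le> rank C"
  shows "ereal_convex_on UNIV (\<lambda>\<psi>. z_linx C A b s (\<chi> i. exp (\<psi> $ i)))"
  unfolding z_linx_def
proof (rule ereal_convex_on_SUP)
  fix x :: "real ^ 'n"
  assume "x \<in> linx_feasible A b s"
  then have "0 \<le> x" "x \<le> 1" by (simp_all add: linx_feasible_def)
  with \<open>psd C\<close> show "ereal_convex_on UNIV (\<lambda>\<psi>. f_linx C x (\<chi> i. exp (\<psi> $ i)))"
    by (rule ereal_convex_on_f_linx_exp)
qed simp

end
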